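(* 1. Let $H$ be a semigroup with finite generating set $\mathcal{B}=\{b_1,\dots,b_k\}$ and let $g\in H$ be an element that generates an infinite subsemigroup of $H$, i.e. $\mathrm{card}\{g^n\}_{n\in\mathbb{N}}=\infty$. Denote $l(i)=|g^i|_{\mathcal{B}}$ for $i\in\mathbb{N}$. Then (C1) $l(i+j)\leq l(i)+l(j)$ for all $i,j\in\mathbb{N}$ ($l$ is subadditive); (C2) there exists a positive number $a$ such that $\mathrm{card}\{i\in\mathbb{N} : l(i)\leq r\}\leq a^r$ for any $r\in\mathbb{N}$. 2. For any function $l:\mathbb{N}\rightarrow\mathbb{N}$ satisfying conditions (C1) and (C2), there is a $2$-generated semigroup $H$ and an element $h\in H$ such that $|h^i|_H\approx l(i)$. 3. For any function $l:\mathbb{N}\rightarrow\mathbb{N}$ satisfying conditions (C1) and (C2), there is a finitely generated semigroup $K$ and an element $k\in K$ such that $|k^i|_K=l(i)$ for all $i\in\mathbb{N}$.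
   Context: Semigroups are not assumed to have an identity element. $\mathbb{N}=\{1,2,3,\dots\}$. For a semigroup $H$ with finite generating set $\mathcal{B}$ and $g\in H$, $|g|_{\mathcal{B}}$ denotes the number of letters in a shortest (nonempty) word over $\mathcal{B}$ representing $g$. $|\cdot|_H$ denotes the word length in $H$ with respect to a finite generating set of $H$; in part 2 the choice of finite generating set is irrelevant up to equivalence, and in part 3 equality holds for a suitable finite generating set of $K$. Two functions $l_1,l_2:\mathbb{N}\to\mathbb{N}$ are equivalent, $l_1\approx l_2$, if there exist constants $c_1,c_2>0$ such that $c_1l_1(i)\leq l_2(i)\leq c_2l_1(i)$ for all $i\in\mathbb{N}$. *)

theory Defs
  imports Complex_Main "HOL-Library.FuncSet"
begin

text \<open>
  A semigroup is given by an associative operation on a whole type (the library predicate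
  \<^const>\<open>semigroup\<close>); an identity element is not required.  The set \<open>\<nat> = {1,2,3,\<dots>}\<close> is
  \<open>{1..}\<close> of type \<open>nat set\<close>: functions \<open>l\<close> on it are represented by functions on \<open>nat\<close> whose
  value at \<open>0\<close> is never used.

  Where the existence of a finitely generated semigroup is asserted, \<open>nat\<close> serves as the
  underlying set: every infinite finitely generated semigroup is countable, hence isomorphic to
  one on \<open>nat\<close>, and (C2) makes the semigroups in question infinite.
\<close>

text \<open>The product of the letters of a word; only meaningful for nonempty words.\<close>

definition word_value :: "('a \<Rightarrow> 'a \<Rightarrow> 'a) \<Rightarrow> 'a list \<Rightarrow> 'a" where
  "word_value mul w = foldl mul (hd w) (tl w)"

text \<open>The power \<open>g\<^sup>n\<close> for \<open>n \<ge> 1\<close>, as the product of \<open>n\<close> copies of \<open>g\<close>.\<close>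

definition sg_power :: "('a \<Rightarrow> 'a \<Rightarrow> 'a) \<Rightarrow> 'a \<Rightarrow> nat \<Rightarrow> 'a" where
  "sg_power mul g n = word_value mul (replicate n g)"

definition words :: "'a set \<Rightarrow> 'a list set" where
  "words B = {w. w \<noteq> [] \<and> set w \<subseteq> B}"

definition generates :: "('a \<Rightarrow> 'a \<Rightarrow> 'a) \<Rightarrow> 'a set \<Rightarrow> bool" where
  "generates mul B \<longleftrightarrow> (\<forall>x. \<exists>w \<in> words B. word_value mul w = x)"

definition word_length :: "('a \<Rightarrow> 'a \<Rightarrow> 'a) \<Rightarrow> 'a set \<Rightarrow> 'a \<Rightarrow> nat" where
  "word_length mul B g = (LEAST n. \<exists>w \<in> words B. word_value mul w = g \<and> length w = n)"

definition C1 :: "(nat \<Rightarrow> nat) \<Rightarrow> bool" where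
  "C1 l \<longleftrightarrow> (\<forall>i\<ge>1. \<forall>j\<ge>1. l (i + j) \<le> l i + l j)"

text \<open>Finiteness is explicit because \<^const>\<open>card\<close> is \<open>0\<close> on infinite sets.\<close>

definition C2 :: "(nat \<Rightarrow> nat) \<Rightarrow> bool" where
  "C2 l \<longleftrightarrow> (\<exists>a::real. a > 0 \<and>
     (\<forall>r\<ge>1. finite {i. i \<ge> 1 \<and> l i \<le> r} \<and> real (card {i. i \<ge> 1 \<and> l i \<le> r}) \<le> a ^ r))"

definition len_equiv :: "(nat \<Rightarrow> nat) \<Rightarrow> (nat \<Rightarrow> nat) \<Rightarrow> bool" where
  "len_equiv l1 l2 \<longleftrightarrow> (\<exists>c1 c2 :: real. c1 > 0 \<and> c2 > 0 \<and>
     (\<forall>i\<ge>1. c1 * real (l1 i) \<le> real (l2 i) \<and> real (l2 i) \<le> c2 * real (l1 i)))"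

end

theory Submission
  imports Defs "HOL-Library.Countable_Set"
begin

text \<open>
  For the first part, a word of length at most \<open>r\<close> represents at most one power of \<open>g\<close>, since the
  powers of \<open>g\<close> are pairwise distinct.

  For the other two parts, (C2) provides enough room to choose pairwise distinct code words
  \<open>v\<^sub>i\<close>, of length \<open>l(i)\<close> over a large alphabet or of length comparable to \<open>l(i)\<close> over a binary
  one, such that an occurrence of a \<open>v\<^sub>i\<close> inside a product of code words is always one of the
  factors.  The semigroup is the quotient of the free semigroup by the syntactic congruence of the
  partial function \<open>v\<^sub>i\<^sub>1 \<cdots> v\<^sub>i\<^sub>s \<mapsto> i\<^sub>1 + \<cdots> + i\<^sub>s\<close>.  In it \<open>v\<^sub>i v\<^sub>j = v\<^sub>i\<^sub>+\<^sub>j\<close>, so \<open>v\<^sub>i\<close> is the \<open>i\<close>-th power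
  of \<open>v\<^sub>1\<close>; and a word equal to \<open>v\<^sub>i\<close> is a product of code words whose indices sum to \<open>i\<close>, hence by
  subadditivity is no shorter than \<open>v\<^sub>i\<close>.
\<close>

section \<open>Word length in semigroups\<close>

lemma words_append: "u \<in> words B \<Longrightarrow> w \<in> words B \<Longrightarrow> u @ w \<in> words B"
  by (auto simp: words_def)

lemma word_value_singleton [simp]: "word_value mul [x] = x"
  by (simp add: word_value_def)

lemma word_value_snoc: "w \<noteq> [] \<Longrightarrow> word_value mul (w @ [x]) = mul (word_value mul w) x"
  by (simp add: word_value_def)

lemma word_value_append:
  assumes "semigroup mul" "u \<noteq> []" "w \<noteq> []"
  shows "word_value mul (u @ w) = mul (word_value mul u) (word_value mul w)"
  using assms(3)
proof (induction w rule: rev_nonempty_induct)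
  case (single x)
  then show ?case by (simp add: word_value_snoc assms(2))
next
  case (snoc x xs)
  have "word_value mul (u @ xs @ [x]) = mul (word_value mul (u @ xs)) x"
    using word_value_snoc[of "u @ xs"] snoc by simp
  then show ?case
    using snoc by (simp add: word_value_snoc semigroup.assoc[OF assms(1)])
qed

lemma sg_power_one [simp]: "sg_power mul g (Suc 0) = g"
  by (simp add: sg_power_def)

lemma sg_power_add:
  assumes "semigroup mul" "i \<ge> 1" "j \<ge> 1"
  shows "sg_power mul g (i + j) = mul (sg_power mul g i) (sg_power mul g j)"
  using assms word_value_append[OF assms(1), of "replicate i g" "replicate j g"]
  by (simp add: sg_power_def replicate_add)

lemma shortest_word:
  assumes "generates mul B"
  obtains w where "w \<in> words B" "word_value mul w = x" "length w = word_length mul B x"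
proof -
  have "\<exists>n. \<exists>w\<in>words B. word_value mul w = x \<and> length w = n"
    using assms unfolding generates_def by blast
  then have "\<exists>w\<in>words B. word_value mul w = x \<and> length w = word_length mul B x"
    unfolding word_length_def by (rule LeastI_ex)
  then show ?thesis using that by blast
qed

lemma word_length_le:
  assumes "w \<in> words B"
  shows "word_length mul B (word_value mul w) \<le> length w"
  unfolding word_length_def using assms by (intro Least_le) auto

lemma word_length_mul_le:
  assumes "semigroup mul" "generates mul B"
  shows "word_length mul B (mul x y) \<le> word_length mul B x + word_length mul B y"
proof -
  obtain u where u: "u \<in> words B" "word_value mul u = x" "length u = word_length mul B x"
    using shortest_word[OF assms(2)] .
  obtain w where w: "w \<in> words B" "word_value mul w = y" "length w = word_length mul B y"
    using shortest_word[OF assms(2)] .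
  have "word_value mul (u @ w) = mul x y"
    using word_value_append[OF assms(1)] u w by (auto simp: words_def)
  then show ?thesis
    using word_length_le[OF words_append[OF u(1) w(1)], of mul] u w by simp
qed

text \<open>Replacing each letter of a shortest word over \<open>B\<close> by a shortest word over
  \<open>S\<close> stretches the length by at most \<open>M\<close>, the largest
  \<open>S\<close>-length of a letter of \<open>B\<close>.\<close>

lemma word_length_change_generators:
  assumes "semigroup mul" "generates mul S" "finite B" "generates mul B"
  obtains M :: nat where "M \<ge> 1" "\<And>x. word_length mul S x \<le> M * word_length mul B x"
proof -
  \<comment> \<open>Inserting 1 keeps the maximum defined and makes \<open>M\<close> positive, so
    that one may later divide by it.\<close>
  define M where "M = Max (insert 1 (word_length mul S ` B))"
  have b: "word_length mul S b \<le> M" if "b \<in> B" for b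
    using assms(3) that by (auto simp: M_def intro!: Max_ge)
  have "1 \<le> M" using assms(3) by (auto simp: M_def intro!: Max_ge)
  moreover have "word_length mul S x \<le> M * word_length mul B x" for x
  proof -
    have *: "word_length mul S (word_value mul w) \<le> M * length w" if "w \<noteq> []" "set w \<subseteq> B" for w
      using that
    proof (induction w rule: rev_nonempty_induct)
      case (single x)
      then show ?case using b by simp
    next
      case (snoc x xs)
      then have "word_length mul S (word_value mul (xs @ [x])) \<le> M * length xs + M"
        using word_length_mul_le[OF assms(1,2), of "word_value mul xs" x] b[of x]
        by (simp add: word_value_snoc)
      then show ?case by simp
    qed
    obtain w where "w \<in> words B" "word_value mul w = x" "length w = word_length mul B x"
      using shortest_word[OF assms(4)] .
    then show ?thesis using *[of w] by (simp add: words_def)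
  qed
  ultimately show ?thesis using that by blast
qed

lemma len_equiv_trans:
  assumes "len_equiv f g" "len_equiv g h"
  shows "len_equiv f h"
proof -
  obtain c d where cd: "c > 0" "d > 0"
    "\<And>i. i \<ge> 1 \<Longrightarrow> c * real (f i) \<le> real (g i)" "\<And>i. i \<ge> 1 \<Longrightarrow> real (g i) \<le> d * real (f i)"
    using assms(1) unfolding len_equiv_def by blast
  obtain c' d' where cd': "c' > 0" "d' > 0"
    "\<And>i. i \<ge> 1 \<Longrightarrow> c' * real (g i) \<le> real (h i)" "\<And>i. i \<ge> 1 \<Longrightarrow> real (h i) \<le> d' * real (g i)"
    using assms(2) unfolding len_equiv_def by blast
  have "c' * c * real (f i) \<le> real (h i) \<and> real (h i) \<le> d' * d * real (f i)" if "i \<ge> 1" for i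
    using cd(3,4)[OF that] cd'(3,4)[OF that] cd(1,2) cd'(1,2)
    by (smt (verit) mult.assoc mult_left_mono)
  then show ?thesis
    unfolding len_equiv_def using cd(1,2) cd'(1,2) by (metis mult_pos_pos)
qed

lemma len_equiv_word_length:
  assumes "semigroup mul" "finite S" "generates mul S" "finite B" "generates mul B"
  shows "len_equiv (\<lambda>i. word_length mul S (x i)) (\<lambda>i. word_length mul B (x i))"
proof -
  obtain M :: nat where M: "M \<ge> 1" "\<And>x. word_length mul S x \<le> M * word_length mul B x"
    using word_length_change_generators[OF assms(1,3,4,5)] by blast
  obtain N :: nat where N: "N \<ge> 1" "\<And>x. word_length mul B x \<le> N * word_length mul S x"
    using word_length_change_generators[OF assms(1,5,2,3)] by blast
  have "(1 / real M) * real (word_length mul S y) \<le> real (word_length mul B y)" for y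
    using M(1) of_nat_mono[OF M(2)[of y], where 'a = real] by (simp add: field_simps)
  moreover have "real (word_length mul B y) \<le> real N * real (word_length mul S y)" for y
    using of_nat_mono[OF N(2)[of y], where 'a = real] by simp
  ultimately show ?thesis
    unfolding len_equiv_def using M(1) N(1)
    by (intro exI[of _ "1 / real M"] exI[of _ "real N"]) auto
qed

section \<open>Lengths of powers\<close>

text \<open>A coincidence of two powers makes the sequence of powers eventually periodic, hence its
  range finite.\<close>

lemma inj_on_sg_power:
  assumes "semigroup mul" "infinite {sg_power mul g n |n. n \<ge> 1}"
  shows "inj_on (sg_power mul g) {1..}"
proof (rule ccontr)
  let ?p = "sg_power mul g"
  assume "\<not> inj_on ?p {1..}"
  then obtain i j where ij: "i \<ge> 1" "i < j" "?p i = ?p j"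
    unfolding inj_on_def by (metis atLeast_iff linorder_neqE_nat)
  have "?p n \<in> ?p ` {1..j}" if "n \<ge> 1" for n
    using that
  proof (induction n rule: less_induct)
    case (less n)
    show ?case
    proof (cases "n \<le> j")
      case True
      then show ?thesis using less by auto
    next
      case False
      \<comment> \<open>Split the exponent as \<open>j + (n - j)\<close> and trade the power
        \<open>j\<close> for the power \<open>i\<close>; the new exponent is still positive but
        smaller than \<open>n\<close>.\<close>
      then have "?p n = ?p (i + (n - j))"
        using sg_power_add[OF assms(1), of i "n - j" g] sg_power_add[OF assms(1), of j "n - j" g] ij
        by simp
      then show ?thesis using less(1)[of "i + (n - j)"] ij False by auto
    qed
  qed
  then have "{?p n |n. n \<ge> 1} \<subseteq> ?p ` {1..j}" by auto
  then show False using assms(2) finite_subset by blast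
qed

lemma C1_word_length:
  assumes "semigroup mul" "generates mul B"
  shows "C1 (\<lambda>i. word_length mul B (sg_power mul g i))"
  unfolding C1_def by (simp add: sg_power_add assms word_length_mul_le)

text \<open>Turns the number of words of length at most \<open>r\<close> over \<open>k\<close>
  letters into the single \<open>r\<close>-th power that (C2) asks for.\<close>

lemma sum_power_le: "(\<Sum>i\<le>r. k ^ i) \<le> (k + 1) ^ r" for k :: nat
proof (induction r)
  case (Suc r)
  have "k ^ Suc r \<le> k * (k + 1) ^ r" by (simp add: power_mono)
  then have "(\<Sum>i\<le>Suc r. k ^ i) \<le> (k + 1) ^ r + k * (k + 1) ^ r"
    using Suc unfolding sum.atMost_Suc by (rule add_mono[rotated])
  then show ?case by simp
qed simp

lemma C2_word_length:
  assumes "semigroup mul" "finite B" "generates mul B" "infinite {sg_power mul g n |n. n \<ge> 1}"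
  shows "C2 (\<lambda>i. word_length mul B (sg_power mul g i))"
proof -
  let ?p = "sg_power mul g"
  let ?I = "\<lambda>r. {i. i \<ge> 1 \<and> word_length mul B (?p i) \<le> r}"
  let ?W = "\<lambda>r. {w. set w \<subseteq> B \<and> length w \<le> r}"
  have "finite (?I r) \<and> card (?I r) \<le> (card B + 1) ^ r" for r
  proof -
    have sub: "?p ` ?I r \<subseteq> word_value mul ` ?W r"
    proof
      fix x assume "x \<in> ?p ` ?I r"
      moreover obtain w where "w \<in> words B" "word_value mul w = x" "length w = word_length mul B x"
        using shortest_word[OF assms(3)] .
      ultimately show "x \<in> word_value mul ` ?W r" by (auto simp: words_def)
    qed
    have finW: "finite (?W r)" using assms(2) by (rule finite_lists_length_le)
    have inj: "inj_on ?p (?I r)"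
      using inj_on_sg_power[OF assms(1,4)] by (rule inj_on_subset) auto
    have fin: "finite (?I r)"
      using finite_imageD[OF finite_subset[OF sub] inj] finW by blast
    have "card (?I r) = card (?p ` ?I r)" using card_image[OF inj] by simp
    also have "\<dots> \<le> card (word_value mul ` ?W r)" using finW by (intro card_mono sub) auto
    also have "\<dots> \<le> card (?W r)" using finW by (rule card_image_le)
    also have "\<dots> \<le> (card B + 1) ^ r"
      using card_lists_length_le[OF assms(2)] sum_power_le by metis
    finally show ?thesis using fin by blast
  qed
  then have "finite (?I r) \<and> real (card (?I r)) \<le> real (card B + 1) ^ r" for r
    by (metis of_nat_le_iff of_nat_power)
  then show ?thesis unfolding C2_def by (intro exI[of _ "real (card B + 1)"]) auto
qed

section \<open>Quotients of free semigroups\<close>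

text \<open>The kernel of \<open>f\<close> is a congruence. Enumerating the countably infinite set
  of values of \<open>f\<close> on nonempty words carries the quotient over to all of
  \<open>nat\<close>, with \<open>\<rho>\<close> choosing representatives.\<close>

lemma quotient_semigroup_on_nat:
  fixes f :: "'a list \<Rightarrow> 'b"
  assumes "finite A" "infinite (f ` words A)"
    and cong: "\<And>u u' w w'. f u = f u' \<Longrightarrow> f w = f w' \<Longrightarrow> f (u @ w) = f (u' @ w')"
  obtains mul :: "nat \<Rightarrow> nat \<Rightarrow> nat" and \<pi> :: "'a list \<Rightarrow> nat"
  where "semigroup mul" "\<pi> ` words A = UNIV"
    "\<And>u w. u \<in> words A \<Longrightarrow> w \<in> words A \<Longrightarrow> \<pi> u = \<pi> w \<longleftrightarrow> f u = f w"
    "\<And>u w. u \<in> words A \<Longrightarrow> w \<in> words A \<Longrightarrow> mul (\<pi> u) (\<pi> w) = \<pi> (u @ w)"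
proof -
  have "countable (lists A)" using assms(1) by (intro countable_lists countable_finite)
  moreover have "words A \<subseteq> lists A" by (auto simp: words_def)
  ultimately have "countable (f ` words A)" by (meson countable_image countable_subset)
  then have bij: "bij_betw (to_nat_on (f ` words A)) (f ` words A) UNIV"
    using assms(2) by (rule to_nat_on_infinite)
  define \<pi> where "\<pi> = to_nat_on (f ` words A) \<circ> f"
  define \<rho> where "\<rho> = inv_into (words A) \<pi>"
  define mul where "mul x y = \<pi> (\<rho> x @ \<rho> y)" for x y
  have surj: "\<pi> ` words A = UNIV"
    using bij unfolding \<pi>_def bij_betw_def by (simp add: image_comp)
  have eq: "\<pi> u = \<pi> w \<longleftrightarrow> f u = f w" if "u \<in> words A" "w \<in> words A" for u w
    using inj_on_eq_iff[OF bij_betw_imp_inj_on[OF bij]] that by (simp add: \<pi>_def)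
  have \<rho>: "\<rho> x \<in> words A" "\<pi> (\<rho> x) = x" for x
    unfolding \<rho>_def using surj by (auto intro: inv_into_into f_inv_into_f)
  have mul: "mul (\<pi> u) (\<pi> w) = \<pi> (u @ w)" if "u \<in> words A" "w \<in> words A" for u w
  proof -
    have "f (\<rho> (\<pi> u)) = f u" "f (\<rho> (\<pi> w)) = f w"
      using that eq[OF \<rho>(1)] \<rho>(2) by blast+
    then have "f (\<rho> (\<pi> u) @ \<rho> (\<pi> w)) = f (u @ w)" by (rule cong)
    then show ?thesis
      unfolding mul_def using eq words_append \<rho>(1) that by blast
  qed
  have "mul (mul x y) z = mul x (mul y z)" for x y z
  proof -
    have "mul (mul x y) z = mul (\<pi> (\<rho> x @ \<rho> y)) (\<pi> (\<rho> z))"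
      by (simp only: \<rho>(2) mul_def[of x y])
    also have "\<dots> = \<pi> (\<rho> x @ \<rho> y @ \<rho> z)" by (simp only: mul words_append \<rho>(1) append_assoc)
    also have "\<dots> = mul (\<pi> (\<rho> x)) (\<pi> (\<rho> y @ \<rho> z))" by (simp only: mul words_append \<rho>(1))
    also have "\<dots> = mul x (mul y z)" by (simp only: \<rho>(2) mul_def[of y z])
    finally show ?thesis .
  qed
  then have "semigroup mul" by unfold_locales
  then show ?thesis using that surj eq mul by blast
qed

section \<open>The syntactic semigroup of a comma-free code\<close>

text \<open>\<open>prefix_free\<close> also makes \<open>v\<close> injective on positive indices.
  \<open>no_overlap\<close> forbids a code word to start strictly inside another one, whether it
  ends there too or runs past the end.\<close>

locale comma_free_code =
  fixes v :: "nat \<Rightarrow> 'a list"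
  assumes nonempty: "i \<ge> 1 \<Longrightarrow> v i \<noteq> []"
    and prefix_free: "i \<ge> 1 \<Longrightarrow> j \<ge> 1 \<Longrightarrow> v i @ q = v j @ r \<Longrightarrow> i = j"
    and no_overlap: "i \<ge> 1 \<Longrightarrow> j \<ge> 1 \<Longrightarrow> v j = s @ t \<Longrightarrow> s \<noteq> [] \<Longrightarrow> t \<noteq> [] \<Longrightarrow> v i @ q \<noteq> t @ r"
begin

text \<open>Compare the start of the occurrence with the first factor: at its beginning
  \<open>prefix_free\<close> identifies the two, beyond its end induction applies, and in between
  \<open>no_overlap\<close> rules it out.\<close>

lemma factor_of_code_word_product:
  assumes "0 \<notin> set js" "i \<ge> 1" "concat (map v js) = p @ v i @ q"
  shows "\<exists>js1 js2. js = js1 @ i # js2 \<and> concat (map v js1) = p \<and> concat (map v js2) = q"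
  using assms(1,3)
proof (induction js arbitrary: p)
  case Nil
  then show ?case using nonempty[OF assms(2)] by simp
next
  case (Cons j js)
  have j: "j \<ge> 1" using Cons.prems by auto
  have eq: "v j @ concat (map v js) = p @ v i @ q" using Cons.prems by simp
  show ?case
  proof (cases "p = []")
    case True
    then have "i = j" using prefix_free[OF assms(2) j] eq by (metis append_Nil)
    then have "j # js = [] @ i # js" "concat (map v js) = q" using eq True by auto
    then show ?thesis using True by (metis concat.simps(1) list.map(1))
  next
    case False
    obtain us where us: "v j @ us = p \<and> concat (map v js) = us @ v i @ q
        \<or> v j = p @ us \<and> us @ concat (map v js) = v i @ q"
      using eq unfolding append_eq_append_conv2 by blast
    show ?thesis
    proof (cases "v j @ us = p \<and> concat (map v js) = us @ v i @ q")
      case True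
      then obtain js1 js2 where "js = js1 @ i # js2" "concat (map v js1) = us"
        "concat (map v js2) = q"
        using Cons.IH[of us] Cons.prems by auto
      then have "j # js = (j # js1) @ i # js2" "concat (map v (j # js1)) = p"
        "concat (map v js2) = q"
        using True by auto
      then show ?thesis by blast
    next
      case *: False
      then have u: "v j = p @ us" "us @ concat (map v js) = v i @ q" using us by auto
      then have "us \<noteq> []" using * by auto
      then show ?thesis using no_overlap[OF assms(2) j u(1) False, of q] u(2) by metis
    qed
  qed
qed

text \<open>The values of the partial index-sum function at \<open>p @ u @ q\<close>, a set that is
  empty where the function is undefined. Equality as functions of the context \<open>p\<close>,
  \<open>q\<close> is the syntactic congruence. Index 0 is excluded because \<open>v 0\<close> is
  unconstrained.\<close>

definition syntactic :: "'a list \<Rightarrow> 'a list \<Rightarrow> 'a list \<Rightarrow> nat set" where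
  "syntactic u p q = {sum_list js |js. 0 \<notin> set js \<and> concat (map v js) = p @ u @ q}"

text \<open>Absorb \<open>w\<close> into the right context to replace \<open>u\<close>, then absorb
  \<open>u'\<close> into the left context to replace \<open>w\<close>.\<close>

lemma syntactic_cong:
  assumes "syntactic u = syntactic u'" "syntactic w = syntactic w'"
  shows "syntactic (u @ w) = syntactic (u' @ w')"
proof (intro ext)
  fix p q
  have "syntactic (u @ w) p q = syntactic u p (w @ q)" by (simp add: syntactic_def)
  also have "\<dots> = syntactic w (p @ u') q" by (simp add: assms(1)) (simp add: syntactic_def)
  also have "\<dots> = syntactic (u' @ w') p q" by (simp add: assms(2)) (simp add: syntactic_def)
  finally show "syntactic (u @ w) p q = syntactic (u' @ w') p q" .
qed

text \<open>Every occurrence of \<open>v i\<close> in a product is a factor, so the admissible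
  contexts do not depend on \<open>i\<close>, and \<open>i\<close> enters the value only as a
  summand.\<close>

lemma syntactic_code_word:
  assumes "i \<ge> 1"
  shows "syntactic (v i) p q = {sum_list js1 + i + sum_list js2 |js1 js2.
    0 \<notin> set js1 \<and> 0 \<notin> set js2 \<and> concat (map v js1) = p \<and> concat (map v js2) = q}"
    (is "_ = ?R")
proof
  show "syntactic (v i) p q \<subseteq> ?R"
  proof
    fix n assume "n \<in> syntactic (v i) p q"
    then obtain js where js: "0 \<notin> set js" "n = sum_list js" "concat (map v js) = p @ v i @ q"
      by (auto simp: syntactic_def)
    obtain js1 js2 where "js = js1 @ i # js2" "concat (map v js1) = p" "concat (map v js2) = q"
      using factor_of_code_word_product[OF js(1) assms js(3)] by blast
    moreover from this have "0 \<notin> set js1" "0 \<notin> set js2" "n = sum_list js1 + i + sum_list js2"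
      using js by auto
    ultimately show "n \<in> ?R" by blast
  qed
  show "?R \<subseteq> syntactic (v i) p q"
  proof
    fix n assume "n \<in> ?R"
    then obtain js1 js2 where "0 \<notin> set js1" "0 \<notin> set js2" "n = sum_list js1 + i + sum_list js2"
      "concat (map v js1) = p" "concat (map v js2) = q" by blast
    then have "n = sum_list (js1 @ i # js2)" "0 \<notin> set (js1 @ i # js2)"
      "concat (map v (js1 @ i # js2)) = p @ v i @ q"
      using assms by auto
    then show "n \<in> syntactic (v i) p q" unfolding syntactic_def by blast
  qed
qed

lemma syntactic_mult_code_words:
  assumes "i \<ge> 1" "j \<ge> 1"
  shows "syntactic (v i @ v j) = syntactic (v (i + j))"
proof (intro ext subset_antisym subsetI)
  fix p q n
  assume "n \<in> syntactic (v i @ v j) p q"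
  then have "n \<in> syntactic (v i) p (v j @ q)" by (simp add: syntactic_def)
  then obtain js1 js where js: "0 \<notin> set js1" "0 \<notin> set js" "n = sum_list js1 + i + sum_list js"
    "concat (map v js1) = p" "concat (map v js) = v j @ q"
    unfolding syntactic_code_word[OF assms(1)] by blast
  \<comment> \<open>Reading \<open>v j @ q\<close> as \<open>v j\<close> in a context with empty
    left part lets the same description split off the factor \<open>v j\<close>.\<close>
  then have "sum_list js \<in> syntactic (v j) [] q" by (auto simp: syntactic_def)
  then obtain ks js2 where ks: "0 \<notin> set ks" "0 \<notin> set js2"
    "sum_list js = sum_list ks + j + sum_list js2"
    "concat (map v ks) = []" "concat (map v js2) = q"
    unfolding syntactic_code_word[OF assms(2)] by blast
  have "ks = []" using ks(1,4) nonempty by (cases ks) auto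
  then have "n = sum_list js1 + (i + j) + sum_list js2" using js ks by simp
  then show "n \<in> syntactic (v (i + j)) p q"
    using js(1,4) ks(2,5) syntactic_code_word[of "i + j" p q] assms by auto
next
  fix p q n
  assume "n \<in> syntactic (v (i + j)) p q"
  then obtain js1 js2 where js: "0 \<notin> set js1" "0 \<notin> set js2"
    "n = sum_list js1 + (i + j) + sum_list js2" "concat (map v js1) = p" "concat (map v js2) = q"
    using syntactic_code_word[of "i + j" p q] assms by auto
  then have "n = sum_list (js1 @ i # j # js2)" "0 \<notin> set (js1 @ i # j # js2)"
    "concat (map v (js1 @ i # j # js2)) = p @ (v i @ v j) @ q"
    using assms by auto
  then show "n \<in> syntactic (v i @ v j) p q" unfolding syntactic_def by blast
qed

text \<open>The empty context recovers the index, so distinct code words stay distinct in the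
  quotient.\<close>

lemma syntactic_code_word_Nil:
  assumes "i \<ge> 1"
  shows "syntactic (v i) [] [] = {i}"
proof -
  have "js = []" if "0 \<notin> set js" "concat (map v js) = []" for js
    using that nonempty by (cases js) auto
  then have "0 \<notin> set js \<and> concat (map v js) = [] \<longleftrightarrow> js = []" for js by auto
  then have "n \<in> syntactic (v i) [] [] \<longleftrightarrow> n = i" for n
    unfolding syntactic_code_word[OF assms] mem_Collect_eq
    by (metis (no_types, lifting) add.left_neutral add.right_neutral sum_list.Nil)
  then show ?thesis by blast
qed

text \<open>Iterated subadditivity; nonempty lists of positive indices keep every partial sum in the
  range of (C1).\<close>

lemma length_product_ge:
  assumes "C1 (\<lambda>i. length (v i))" "js \<noteq> []" "0 \<notin> set js"
  shows "length (v (sum_list js)) \<le> length (concat (map v js))"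
  using assms(2,3)
proof (induction js rule: list_nonempty_induct)
  case (cons j js)
  have "sum_list js \<ge> 1" using cons by (cases js) auto
  then have "length (v (j + sum_list js)) \<le> length (v j) + length (v (sum_list js))"
    using assms(1) cons.prems unfolding C1_def by auto
  then show ?case using cons by simp
qed simp

lemma syntactic_eq_code_word_length:
  assumes "C1 (\<lambda>i. length (v i))" "i \<ge> 1" "syntactic w = syntactic (v i)"
  shows "length (v i) \<le> length w"
proof -
  have "i \<in> syntactic w [] []" using assms(2,3) by (simp add: syntactic_code_word_Nil)
  then obtain js where js: "0 \<notin> set js" "i = sum_list js" "concat (map v js) = w"
    by (auto simp: syntactic_def)
  then have "js \<noteq> []" using assms(2) by auto
  then show ?thesis using length_product_ge[OF assms(1)] js by blast
qed

text \<open>Keeps two letters apart in the quotient: \<open>tl (v 1)\<close> completes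
  \<open>hd (v 1)\<close> to a code word, whereas no product of code words begins with
  \<open>b\<close>.\<close>

lemma syntactic_first_letter:
  assumes "\<And>j. j \<ge> 1 \<Longrightarrow> hd (v j) \<noteq> b"
  shows "syntactic [hd (v 1)] \<noteq> syntactic [b]"
proof
  assume eq: "syntactic [hd (v 1)] = syntactic [b]"
  have "syntactic [hd (v 1)] [] (tl (v 1)) = syntactic (v 1) [] []"
    using nonempty[of 1] unfolding syntactic_def by simp
  then have "1 \<in> syntactic [b] [] (tl (v 1))" using eq syntactic_code_word_Nil[of 1] by simp
  then obtain js where js: "0 \<notin> set js" "concat (map v js) = b # tl (v 1)"
    unfolding syntactic_def by auto
  then obtain j ks where "js = j # ks" "j \<ge> 1" by (cases js) auto
  then show False using assms[of j] nonempty[of j] js by (cases "v j") auto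
qed

lemma syntactic_semigroup:
  assumes "finite A" "\<And>i. i \<ge> 1 \<Longrightarrow> set (v i) \<subseteq> A" "C1 (\<lambda>i. length (v i))"
  obtains mul :: "nat \<Rightarrow> nat \<Rightarrow> nat" and \<gamma> h
  where "semigroup mul" "generates mul (\<gamma> ` A)"
    "\<And>i. i \<ge> 1 \<Longrightarrow> word_length mul (\<gamma> ` A) (sg_power mul h i) = length (v i)"
    "\<And>b. b \<in> A \<Longrightarrow> (\<And>j. j \<ge> 1 \<Longrightarrow> hd (v j) \<noteq> b) \<Longrightarrow> \<gamma> (hd (v 1)) \<noteq> \<gamma> b"
proof -
  have vA: "v i \<in> words A" if "i \<ge> 1" for i
    using assms(2) nonempty that by (auto simp: words_def)
  have "inj_on (syntactic \<circ> v) {1..}"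
  proof (rule inj_onI)
    fix i j :: nat
    assume *: "i \<in> {1..}" "j \<in> {1..}" "(syntactic \<circ> v) i = (syntactic \<circ> v) j"
    then have "syntactic (v i) [] [] = syntactic (v j) [] []" by simp
    then show "i = j" using *(1,2) syntactic_code_word_Nil by (metis atLeast_iff singleton_inject)
  qed
  \<comment> \<open>The classes of the code words alone already make the quotient infinite, as a
    carrier \<open>nat\<close> requires.\<close>
  then have "infinite ((syntactic \<circ> v) ` {1..})" using finite_imageD infinite_Ici by blast
  moreover have "(syntactic \<circ> v) ` {1..} \<subseteq> syntactic ` words A" using vA by auto
  ultimately have "infinite (syntactic ` words A)" using finite_subset by blast
  then obtain mul :: "nat \<Rightarrow> nat \<Rightarrow> nat" and \<pi> where
    sg: "semigroup mul" and surj: "\<pi> ` words A = UNIV"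
    and eq: "\<And>u w. u \<in> words A \<Longrightarrow> w \<in> words A \<Longrightarrow> \<pi> u = \<pi> w \<longleftrightarrow> syntactic u = syntactic w"
    and mul: "\<And>u w. u \<in> words A \<Longrightarrow> w \<in> words A \<Longrightarrow> mul (\<pi> u) (\<pi> w) = \<pi> (u @ w)"
    using quotient_semigroup_on_nat[OF assms(1), of syntactic, OF _ syntactic_cong] by blast
  define \<gamma> where "\<gamma> a = \<pi> [a]" for a
  have word_value_map: "word_value mul (map \<gamma> w) = \<pi> w" if "w \<noteq> []" "set w \<subseteq> A" for w
    using that
  proof (induction w rule: rev_nonempty_induct)
    case (single x)
    then show ?case by (simp add: \<gamma>_def)
  next
    case (snoc x xs)
    then show ?case using mul[of xs "[x]"] by (simp add: word_value_snoc words_def \<gamma>_def)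
  qed
  \<comment> \<open>Words over the generators lift letter by letter to words over \<open>A\<close>
    of equal length, so lengths can be compared in the free semigroup.\<close>
  have words_image: "words (\<gamma> ` A) = map \<gamma> ` words A"
  proof -
    have "lists (\<gamma> ` A) = map \<gamma> ` lists A" by (rule lists_image)
    then show ?thesis unfolding words_def lists_eq_set by auto
  qed
  have gen: "generates mul (\<gamma> ` A)"
    unfolding generates_def words_image
  proof
    fix x
    obtain w where "w \<in> words A" "x = \<pi> w" using surj by (metis UNIV_I imageE)
    then show "\<exists>w\<in>map \<gamma> ` words A. word_value mul w = x"
      using word_value_map[of w] by (auto simp: words_def)
  qed
  have power: "sg_power mul (\<pi> (v 1)) i = \<pi> (v i)" if "i \<ge> 1" for i
    using that
  proof (induction i rule: nat_induct_at_least)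
    case (Suc i)
    have "sg_power mul (\<pi> (v 1)) (i + 1) = \<pi> (v i @ v 1)"
      using sg_power_add[OF sg, of i 1] mul[OF vA vA] Suc by simp
    also have "\<dots> = \<pi> (v (i + 1))"
      using eq[OF words_append[OF vA vA] vA, of i 1 "i + 1"] syntactic_mult_code_words[of i 1] Suc
      by simp
    finally show ?case by simp
  qed simp
  have len: "word_length mul (\<gamma> ` A) (\<pi> (v i)) = length (v i)" if i: "i \<ge> 1" for i
  proof (rule antisym)
    show "word_length mul (\<gamma> ` A) (\<pi> (v i)) \<le> length (v i)"
      using word_length_le[of "map \<gamma> (v i)" "\<gamma> ` A" mul] word_value_map[of "v i"] vA[OF i]
      unfolding words_image by (auto simp: words_def)
    obtain w' where w': "w' \<in> map \<gamma> ` words A" "word_value mul w' = \<pi> (v i)"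
      "length w' = word_length mul (\<gamma> ` A) (\<pi> (v i))"
      using shortest_word[OF gen] unfolding words_image .
    obtain w where w: "w \<in> words A" "w' = map \<gamma> w" using w'(1) by blast
    have "\<pi> w = \<pi> (v i)" using word_value_map[of w] w w'(2) by (simp add: words_def)
    then have "syntactic w = syntactic (v i)" using eq[OF w(1) vA[OF i]] by simp
    then show "length (v i) \<le> word_length mul (\<gamma> ` A) (\<pi> (v i))"
      using syntactic_eq_code_word_length[OF assms(3) i] w(2) w'(3) by fastforce
  qed
  have "\<gamma> (hd (v 1)) \<noteq> \<gamma> b" if "b \<in> A" "\<And>j. j \<ge> 1 \<Longrightarrow> hd (v j) \<noteq> b" for b
  proof -
    have "hd (v 1) \<in> A" using vA[of 1] by (auto simp: words_def)
    then show ?thesis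
      using syntactic_first_letter[OF that(2)] that(1) eq by (auto simp: \<gamma>_def words_def)
  qed
  then show ?thesis using that[OF sg gen, of "\<pi> (v 1)"] power len by simp
qed

end

section \<open>Choosing the code words\<close>

text \<open>For each \<open>r\<close>, at most \<open>a ^ r\<close> indices have
  \<open>l i = r\<close>, and there are at least as many words of length \<open>c * r\<close> over
  \<open>D\<close>. The injections for different \<open>r\<close> fit together because the length of
  a word determines \<open>r\<close>.\<close>

lemma injective_words:
  fixes a :: real and D :: "'d set"
  assumes "finite D" "c \<ge> 1" "\<And>i. i \<ge> 1 \<Longrightarrow> l i \<ge> 1"
    and "\<And>r. r \<ge> 1 \<Longrightarrow> finite {i. i \<ge> 1 \<and> l i \<le> r} \<and> real (card {i. i \<ge> 1 \<and> l i \<le> r}) \<le> a ^ r"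
    and "0 \<le> a" "a \<le> real (card D ^ c)"
  obtains x :: "nat \<Rightarrow> 'd list"
  where "inj_on x {1..}" "\<And>i. i \<ge> 1 \<Longrightarrow> length (x i) = c * l i" "\<And>i. i \<ge> 1 \<Longrightarrow> set (x i) \<subseteq> D"
proof -
  let ?I = "\<lambda>r. {i. i \<ge> 1 \<and> l i = r}" and ?W = "\<lambda>r. {w. set w \<subseteq> D \<and> length w = c * r}"
  have "\<exists>f. inj_on f (?I r) \<and> f ` ?I r \<subseteq> ?W r" if r: "r \<ge> 1" for r
  proof -
    have sub: "?I r \<subseteq> {i. i \<ge> 1 \<and> l i \<le> r}" by auto
    have fin: "finite (?I r)" using assms(4)[OF r] finite_subset[OF sub] by blast
    have "card (?I r) \<le> card {i. i \<ge> 1 \<and> l i \<le> r}"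
      using assms(4)[OF r] by (intro card_mono sub) auto
    then have "real (card (?I r)) \<le> a ^ r"
      using assms(4)[OF r] by linarith
    also have "\<dots> \<le> real (card D ^ c) ^ r" using assms(5,6) by (intro power_mono)
    also have "\<dots> = real (card (?W r))"
      by (simp add: card_lists_length_eq[OF assms(1)] power_mult)
    finally have "card (?I r) \<le> card (?W r)" by simp
    then show ?thesis
      using card_le_inj[OF fin finite_lists_length_eq[OF assms(1)]] by blast
  qed
  then have "\<forall>r\<in>{1..}. \<exists>f. inj_on f (?I r) \<and> f ` ?I r \<subseteq> ?W r" by simp
  then obtain f where "\<forall>r\<in>{1..}. inj_on (f r) (?I r) \<and> f r ` ?I r \<subseteq> ?W r"
    by (rule bchoice[THEN exE])
  then have f: "inj_on (f r) (?I r) \<and> f r ` ?I r \<subseteq> ?W r" if "r \<ge> 1" for r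
    using that by simp
  define x where "x i = f (l i) i" for i
  have x: "set (x i) \<subseteq> D" "length (x i) = c * l i" if "i \<ge> 1" for i
    using f[OF assms(3)[OF that]] that by (auto simp: x_def)
  have "inj_on x {1..}"
  proof (rule inj_onI)
    fix i j :: nat assume ij: "i \<in> {1..}" "j \<in> {1..}" "x i = x j"
    then have "c * l i = c * l j" using x(2) by (metis atLeast_iff)
    then have "l i = l j" using assms(2) by simp
    then show "i = j"
      using f[OF assms(3)[of i]] ij unfolding x_def inj_on_def by auto
  qed
  then show ?thesis using that x by blast
qed

section \<open>Comma-free words over a large alphabet, without change of length\<close>

text \<open>The two flags mark the first and the last letter of a code word; they make the code comma-free.\<close>

fun flagged :: "bool \<Rightarrow> 'd list \<Rightarrow> (bool \<times> bool \<times> 'd) list" where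
  "flagged f [] = []"
| "flagged f (d # ds) = (f, ds = [], d) # flagged False ds"

lemma length_flagged [simp]: "length (flagged f ds) = length ds"
  by (induction ds arbitrary: f) auto

lemma flagged_eq_Nil [simp]: "flagged f ds = [] \<longleftrightarrow> ds = []"
  by (cases ds) auto

lemma set_flagged: "set (flagged f ds) \<subseteq> UNIV \<times> UNIV \<times> set ds"
  by (induction ds arbitrary: f) fastforce+

text \<open>The last-letter flag shows where the word ends. The first flag is left arbitrary because
  the recursion resets it to \<open>False\<close>.\<close>

lemma flagged_prefix_free:
  "ds \<noteq> [] \<Longrightarrow> es \<noteq> [] \<Longrightarrow> flagged f ds @ q = flagged f es @ r \<Longrightarrow> ds = es"
proof (induction ds arbitrary: f es)
  case (Cons d ds)
  then obtain e es' where "es = e # es'" by (cases es) auto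
  then show ?case using Cons by (cases "ds = []") auto
qed simp

lemma not_first_flagged: "x \<in> set (flagged False ds) \<Longrightarrow> \<not> fst x"
  by (induction ds) auto

text \<open>A proper suffix \<open>t\<close> starts with a letter whose first flag is
  \<open>False\<close>, a code word with one whose first flag is \<open>True\<close>.\<close>

lemma flagged_no_overlap:
  assumes "ds \<noteq> []" "flagged True es = s @ t" "s \<noteq> []" "t \<noteq> []"
  shows "flagged True ds @ q \<noteq> t @ r"
proof
  assume eq: "flagged True ds @ q = t @ r"
  have "fst (hd t)" using eq assms(1,4) by (cases ds; cases t) auto
  moreover have "hd t \<in> set (tl (flagged True es))" using assms by (cases s) auto
  then have "\<not> fst (hd t)" using not_first_flagged[of "hd t"] by (cases es) auto
  ultimately show False by simp
qed

section \<open>Comma-free words over the binary alphabet\<close>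

text \<open>Two consecutive \<open>False\<close> occur only at the start of a code word.\<close>

fun payload :: "bool list \<Rightarrow> bool list" where
  "payload [] = [False, True]"
| "payload (b # bs) = True # b # True # payload bs"

definition marked :: "bool list \<Rightarrow> bool list" where
  "marked bs = False # False # payload bs"

lemma length_marked: "length (marked bs) = 3 * length bs + 4"
  unfolding marked_def by (induction bs) auto

text \<open>A block for a bit starts with \<open>True\<close> and the terminator with
  \<open>False\<close>, so the end of the payload is recognisable.\<close>

lemma payload_prefix_free: "payload bs @ q = payload cs @ r \<Longrightarrow> bs = cs"
proof (induction bs arbitrary: cs)
  case Nil
  then show ?case by (cases cs) auto
next
  case (Cons b bs)
  then show ?case by (cases cs) auto
qed

text \<open>A payload contains no two consecutive \<open>False\<close> and ends in
  \<open>True\<close>, so each nonempty suffix has a \<open>True\<close> among its first two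
  letters.\<close>

lemma payload_no_overlap: "payload bs = s @ t \<Longrightarrow> t \<noteq> [] \<Longrightarrow> False # False # q \<noteq> t @ r"
proof (induction bs arbitrary: s)
  case Nil
  then show ?case by (auto simp: Cons_eq_append_conv)
next
  case (Cons b bs)
  then show ?case by (auto simp: Cons_eq_append_conv)
qed

text \<open>For nonempty \<open>cs\<close> the payload starts with \<open>True\<close>, so the
  second marker letter does not begin another pair of \<open>False\<close>. For empty
  \<open>cs\<close> the word would start with three \<open>False\<close>, and the marker would occur
  twice.\<close>

lemma marked_no_overlap:
  assumes "cs \<noteq> []" "marked cs = s @ t" "s \<noteq> []" "t \<noteq> []"
  shows "marked bs @ q \<noteq> t @ r"
proof -
  consider "t = False # payload cs" | s' where "payload cs = s' @ t"
    using assms(2,3) unfolding marked_def by (auto simp: Cons_eq_append_conv)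
  then show ?thesis
  proof cases
    case 1
    then show ?thesis using assms(1) by (cases cs) (auto simp: marked_def)
  next
    case 2
    then show ?thesis using payload_no_overlap assms(4) unfolding marked_def by fastforce
  qed
qed

section \<open>Realising length functions\<close>

lemma two_generated_realisation:
  assumes l: "l \<in> {1..} \<rightarrow> {1..}" and "C1 l" "C2 l"
  shows "\<exists>(mul :: nat \<Rightarrow> nat \<Rightarrow> nat) h. semigroup mul \<and> (\<exists>B. card B = 2 \<and> generates mul B) \<and>
    (\<forall>S. finite S \<longrightarrow> generates mul S \<longrightarrow>
      len_equiv (\<lambda>i. word_length mul S (sg_power mul h i)) l)"
proof -
  have l1: "l i \<ge> 1" if "i \<ge> 1" for i using l that by auto
  obtain a :: real where a: "a > 0"
    "\<And>r. r \<ge> 1 \<Longrightarrow> finite {i. i \<ge> 1 \<and> l i \<le> r} \<and> real (card {i. i \<ge> 1 \<and> l i \<le> r}) \<le> a ^ r"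
    using assms(3) unfolding C2_def by blast
  obtain c :: nat where "a < 2 ^ c" using real_arch_pow[of 2 a] by auto
  \<comment> \<open>The successor provides a positive factor even if \<open>a < 1\<close> allows
    \<open>c = 0\<close>.\<close>
  then have c: "a \<le> real (card (UNIV :: bool set) ^ Suc c)" using a(1) by simp
  obtain x :: "nat \<Rightarrow> bool list" where x: "inj_on x {1..}"
    "\<And>i. i \<ge> 1 \<Longrightarrow> length (x i) = Suc c * l i"
    using injective_words[of "UNIV :: bool set" "Suc c" l a] l1 a c by auto
  have xne: "x i \<noteq> []" if "i \<ge> 1" for i using x(2)[OF that] l1[OF that] by auto
  define v where "v i = marked (x i)" for i
  have len: "length (v i) = 3 * (Suc c * l i) + 4" if "i \<ge> 1" for i
    using x(2)[OF that] by (simp add: v_def length_marked)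
  interpret comma_free_code v
  proof
    fix i j :: nat and q r s t assume ij: "i \<ge> 1" "j \<ge> 1"
    show "i = j" if "v i @ q = v j @ r"
      using that payload_prefix_free[of "x i" q "x j" r] inj_onD[OF x(1)] ij
      by (simp add: v_def marked_def)
    show "v i @ q \<noteq> t @ r" if "v j = s @ t" "s \<noteq> []" "t \<noteq> []"
      using marked_no_overlap[OF xne[OF ij(2)]] that unfolding v_def by blast
  qed (simp add: v_def marked_def)
  have C1: "C1 (\<lambda>i. length (v i))"
    unfolding C1_def
  proof (intro allI impI)
    fix i j :: nat assume ij: "i \<ge> 1" "j \<ge> 1"
    have "Suc c * l (i + j) \<le> Suc c * (l i + l j)"
      using assms(2) ij unfolding C1_def by (intro mult_le_mono2) auto
    \<comment> \<open>The constant 4 occurs once on the left and twice on the right.\<close>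
    then show "length (v (i + j)) \<le> length (v i) + length (v j)"
      using ij by (simp only: len add_mult_distrib2)
  qed
  obtain mul :: "nat \<Rightarrow> nat \<Rightarrow> nat" and \<gamma> h where
    sg: "semigroup mul" and gen: "generates mul (range \<gamma>)"
    and power: "\<And>i. i \<ge> 1 \<Longrightarrow> word_length mul (range \<gamma>) (sg_power mul h i) = length (v i)"
    and \<gamma>: "\<And>b. (\<And>j. j \<ge> 1 \<Longrightarrow> hd (v j) \<noteq> b) \<Longrightarrow> \<gamma> (hd (v 1)) \<noteq> \<gamma> b"
    using syntactic_semigroup[of "UNIV :: bool set"] C1 by (metis UNIV_I finite subset_UNIV)
  \<comment> \<open>All code words begin with \<open>False\<close>, so the two letters have
    different images and the generating set has exactly two elements.\<close>
  have "\<gamma> False \<noteq> \<gamma> True" using \<gamma>[of True] by (simp add: v_def marked_def)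
  then have card: "card (range \<gamma>) = 2" by (simp add: UNIV_bool)
  have "len_equiv (\<lambda>i. word_length mul (range \<gamma>) (sg_power mul h i)) l"
    unfolding len_equiv_def
  proof (intro exI conjI allI impI)
    fix i :: nat assume i: "i \<ge> 1"
    let ?L = "word_length mul (range \<gamma>) (sg_power mul h i)" and ?m = "3 * Suc c + 4"
    have L: "?L = 3 * (Suc c * l i) + 4" using power len i by simp
    \<comment> \<open>The additive 4 is absorbed into \<open>4 * l i\<close> since
      \<open>l i\<close> is at least 1.\<close>
    have "?L \<le> ?m * l i" using L l1[OF i] by (simp add: algebra_simps)
    then have "real ?L \<le> real ?m * real (l i)" by (metis of_nat_le_iff of_nat_mult)
    then show "1 / real ?m * real ?L \<le> real (l i)" by (simp add: field_simps)
    show "real (l i) \<le> 1 * real ?L" using L by simp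
  qed simp_all
  then have "len_equiv (\<lambda>i. word_length mul S (sg_power mul h i)) l"
    if "finite S" "generates mul S" for S
    by (rule len_equiv_trans[OF len_equiv_word_length[OF sg that finite_imageI[OF finite] gen]])
  then show ?thesis using sg gen card by blast
qed

lemma exact_realisation:
  assumes l: "l \<in> {1..} \<rightarrow> {1..}" and "C1 l" "C2 l"
  shows "\<exists>(mul :: nat \<Rightarrow> nat \<Rightarrow> nat) S k. semigroup mul \<and> finite S \<and> generates mul S \<and>
    (\<forall>i\<ge>1. word_length mul S (sg_power mul k i) = l i)"
proof -
  have l1: "l i \<ge> 1" if "i \<ge> 1" for i using l that by auto
  obtain a :: real where a: "a > 0"
    "\<And>r. r \<ge> 1 \<Longrightarrow> finite {i. i \<ge> 1 \<and> l i \<le> r} \<and> real (card {i. i \<ge> 1 \<and> l i \<le> r}) \<le> a ^ r"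
    using assms(3) unfolding C2_def by blast
  \<comment> \<open>With \<open>n\<close> payload letters, words of length exactly
    \<open>l i\<close> suffice, and flags enlarge the alphabet but not the length.\<close>
  obtain n :: nat where n: "a \<le> real n" using real_arch_simple by blast
  obtain x :: "nat \<Rightarrow> nat list" where x: "inj_on x {1..}"
    "\<And>i. i \<ge> 1 \<Longrightarrow> length (x i) = l i" "\<And>i. i \<ge> 1 \<Longrightarrow> set (x i) \<subseteq> {..<n}"
    using injective_words[of "{..<n}" 1 l a] l1 a n by auto
  have xne: "x i \<noteq> []" if "i \<ge> 1" for i using x(2)[OF that] l1[OF that] by auto
  define v where "v i = flagged True (x i)" for i
  interpret comma_free_code v
  proof
    fix i j :: nat and q r s t assume ij: "i \<ge> 1" "j \<ge> 1"
    show "i = j" if "v i @ q = v j @ r"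
      using that flagged_prefix_free[OF xne xne] inj_onD[OF x(1)] ij unfolding v_def by force
    show "v i @ q \<noteq> t @ r" if "v j = s @ t" "s \<noteq> []" "t \<noteq> []"
      using flagged_no_overlap[OF xne[OF ij(1)]] that unfolding v_def by blast
  qed (simp add: v_def xne)
  let ?A = "(UNIV :: bool set) \<times> (UNIV :: bool set) \<times> {..<n}"
  have fin: "finite ?A" by simp
  have A: "set (v i) \<subseteq> ?A" if "i \<ge> 1" for i
    using set_flagged[of True "x i"] x(3)[OF that] unfolding v_def by blast
  have C1: "C1 (\<lambda>i. length (v i))"
    using assms(2) x(2) by (simp add: C1_def v_def)
  show ?thesis
  proof (rule syntactic_semigroup[OF fin _ C1])
    fix mul :: "nat \<Rightarrow> nat \<Rightarrow> nat" and \<gamma> h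
    assume "semigroup mul" "generates mul (\<gamma> ` ?A)"
      and "\<And>i. i \<ge> 1 \<Longrightarrow> word_length mul (\<gamma> ` ?A) (sg_power mul h i) = length (v i)"
    moreover have "\<forall>i\<ge>1. length (v i) = l i" using x(2) by (simp add: v_def)
    ultimately show ?thesis
      by (intro exI[of _ mul] exI[of _ "\<gamma> ` ?A"] exI[of _ h]) (simp add: fin)
  qed (rule A)
qed

theorem corollary1p5:
  shows
    "(\<forall>(mul :: 'a \<Rightarrow> 'a \<Rightarrow> 'a) B g.
        semigroup mul \<longrightarrow> finite B \<longrightarrow> generates mul B \<longrightarrow>
        infinite {sg_power mul g n |n. n \<ge> 1} \<longrightarrow>
        C1 (\<lambda>i. word_length mul B (sg_power mul g i)) \<and>
        C2 (\<lambda>i. word_length mul B (sg_power mul g i)))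
     \<and>
     (\<forall>l \<in> {1..} \<rightarrow> {1..}. C1 l \<longrightarrow> C2 l \<longrightarrow>
        (\<exists>(mul :: nat \<Rightarrow> nat \<Rightarrow> nat) h.
           semigroup mul \<and>
           (\<exists>B. card B = 2 \<and> generates mul B) \<and>
           (\<forall>S. finite S \<longrightarrow> generates mul S \<longrightarrow>
              len_equiv (\<lambda>i. word_length mul S (sg_power mul h i)) l)))
     \<and>
     (\<forall>l \<in> {1..} \<rightarrow> {1..}. C1 l \<longrightarrow> C2 l \<longrightarrow>
        (\<exists>(mul :: nat \<Rightarrow> nat \<Rightarrow> nat) S k.
           semigroup mul \<and> finite S \<and> generates mul S \<and>
           (\<forall>i\<ge>1. word_length mul S (sg_power mul k i) = l i)))"
  by (intro conjI allI ballI impI C1_word_length C2_word_length two_generated_realisation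
      exact_realisation; assumption)

end
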